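(* For every integer $d\geq 2$, $k(d,\,2^{d-1}+1-d)=1$. In other words, every $2$-neighborly centrally symmetric $d$-dimensional polytope has at most $2^{d}$ vertices.
   Context: A polytope $P\subset\mathbb{R}^d$ (convex hull of finitely many points) is centrally symmetric (cs) if $x\in P$ implies $-x\in P$. A $d$-polytope is a polytope of dimension $d$. A cs polytope $P$ with $2m$ vertices is called $k$-neighborly, where $1\le k\le m$ is an integer, if every set of $k$ of its vertices, no two of which are antipodal (i.e. no two of the form $v,-v$), is the vertex set of a face of $P$. For integers $d\ge 2$, $n\ge 1$, $k(d,n)$ denotes the largest integer $k$ such that there exists a $k$-neighborly cs $d$-polytope with exactly $2(n+d)$ vertices. *)

theory Defs
  imports "HOL-Analysis.Analysis"
begin

definition vertices :: "'a::real_vector set \<Rightarrow> 'a set" where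
  "vertices P = {v. v extreme_point_of P}"

definition centrally_symmetric :: "'a::real_vector set \<Rightarrow> bool" where
  "centrally_symmetric P \<longleftrightarrow> (\<forall>x\<in>P. - x \<in> P)"

definition cs_polytope :: "'a::real_vector set \<Rightarrow> bool" where
  "cs_polytope P \<longleftrightarrow> polytope P \<and> centrally_symmetric P"

definition cs_neighborly :: "nat \<Rightarrow> 'a::real_vector set \<Rightarrow> bool" where
  "cs_neighborly k P \<longleftrightarrow>
     cs_polytope P \<and>
     (\<exists>m. card (vertices P) = 2 * m \<and> 1 \<le> k \<and> k \<le> m) \<and>
     (\<forall>S. S \<subseteq> vertices P \<and> card S = k \<and> (\<forall>v\<in>S. - v \<notin> S) \<longrightarrow>
          (\<exists>F. F face_of P \<and> vertices F = S))"

text \<open>The number $k(d,n)$. The dimension $d$ is \<open>CARD('d)\<close>, passed as a type argument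
  because it determines the ambient space. The maximum is over a set bounded by $n + d$, since
  \<^const>\<open>cs_neighborly\<close> includes $k \le m$; the value is unspecified if that set is empty.\<close>

definition max_cs_neighborliness :: "'d::finite itself \<Rightarrow> nat \<Rightarrow> nat" where
  "max_cs_neighborliness (_ :: 'd itself) n =
     (GREATEST k. \<exists>P :: (real ^ 'd) set.
        cs_neighborly k P \<and> aff_dim P = int CARD('d) \<and>
        card (vertices P) = 2 * (n + CARD('d)))"

end

theory Submission
  imports Defs
begin

text \<open>Let \<open>P\<close> be 2-neighborly with vertex set \<open>V\<close>. The copies \<open>(v + int P) / 2\<close>, \<open>v \<in> V\<close>,
  lie in \<open>P\<close>. They are pairwise disjoint: a common point of the copies for \<open>u\<close> and \<open>v\<close> makes the
  midpoint of \<open>u\<close> and \<open>-v\<close> an interior point of \<open>P\<close>, but this midpoint lies on the edge joining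
  \<open>u\<close> and \<open>-v\<close>, or is a vertex if \<open>v = -u\<close>. Comparing volumes gives \<open>card V \<le> 2^d\<close>.
  Neighborliness is inherited by smaller \<open>k\<close>, so no polytope with \<open>2^d + 2\<close> vertices is
  \<open>k\<close>-neighborly with \<open>k \<ge> 2\<close>; and a polytope with that many vertices is obtained from the cube
  by adding two antipodal points of its circumscribed sphere.\<close>

section \<open>Vertices, faces and antipodal pairs\<close>

lemma vertices_face_of: "F face_of P \<Longrightarrow> vertices F = vertices P \<inter> F"
  by (auto simp: vertices_def extreme_point_of_face)

lemma vertices_subset: "vertices P \<subseteq> P"
  by (auto simp: vertices_def extreme_point_of_def)

lemma vertices_Int_faces:
  assumes "F face_of P" "G face_of P"
  shows "vertices (F \<inter> G) = vertices F \<inter> vertices G"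
  using vertices_face_of[OF assms(1)] vertices_face_of[OF assms(2)]
    vertices_face_of[OF face_of_Int[OF assms]] by auto

lemma centrally_symmetric_uminus:
  "centrally_symmetric P \<Longrightarrow> x \<in> P \<Longrightarrow> - x \<in> P"
  by (simp add: centrally_symmetric_def)

lemma uminus_in_vertices:
  assumes "centrally_symmetric P" "v \<in> vertices P"
  shows "- v \<in> vertices P"
proof -
  have "- v \<notin> open_segment a b" if "a \<in> P" "b \<in> P" for a b
  proof
    assume "- v \<in> open_segment a b"
    then obtain t where t: "a \<noteq> b" "0 < t" "t < 1" "- v = (1 - t) *\<^sub>R a + t *\<^sub>R b"
      by (auto simp: in_segment)
    have "v = - ((1 - t) *\<^sub>R a + t *\<^sub>R b)"
      using t(4) by (metis minus_minus)
    then have "v = (1 - t) *\<^sub>R (- a) + t *\<^sub>R (- b)"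
      by simp
    then have "v \<in> open_segment (- a) (- b)"
      using t(1-3) unfolding in_segment by (metis neg_equal_iff_equal)
    then show False
      using assms that centrally_symmetric_uminus[OF assms(1)]
      by (auto simp: vertices_def extreme_point_of_def)
  qed
  then show ?thesis
    using assms centrally_symmetric_uminus[OF assms(1)]
    by (auto simp: vertices_def extreme_point_of_def)
qed

text \<open>If 0 were extreme, a nonzero \<open>x\<close> in \<open>P\<close> would put it strictly
  between \<open>x\<close> and \<open>-x\<close>; so \<open>P\<close> would be {0}, with one vertex,
  an odd number. This guarantees that a vertex differs from its antipode.\<close>

lemma zero_notin_vertices:
  assumes "convex P" "centrally_symmetric P" "even (card (vertices P))"
  shows "0 \<notin> vertices P"
proof
  assume 0: "0 \<in> vertices P"
  have "x = 0" if "x \<in> P" for x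
  proof (rule ccontr)
    assume "x \<noteq> 0"
    then have "0 \<in> open_segment x (- x)"
      unfolding in_segment by (auto intro!: exI[of _ "1/2"])
        (metis add_eq_0_iff scaleR_half_double scaleR_zero_right)
    then show False
      using 0 that centrally_symmetric_uminus[OF assms(2) that]
      by (auto simp: vertices_def extreme_point_of_def)
  qed
  then have "vertices P = {0}"
    using 0 vertices_subset[of P] by blast
  then show False
    using assms(3) by simp
qed

lemma uminus_neq_self:
  fixes v :: "'a::real_vector"
  assumes "v \<noteq> 0"
  shows "- v \<noteq> v"
  using assms by (metis add.right_inverse scaleR_2 scaleR_eq_0_iff zero_neq_numeral)

text \<open>Greedy extension: an antipode-free \<open>T\<close> with \<open>k < m\<close> elements
  and its antipodes cover at most \<open>2 * k\<close> of the \<open>2 * m\<close> points, so a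
  point \<open>w\<close> outside both is available. Adding \<open>w\<close> keeps the set
  antipode-free, as \<open>w\<close> is nonzero and \<open>-w\<close> is not in
  \<open>T\<close>.\<close>

lemma extend_antipode_free:
  fixes V :: "'a::real_vector set"
  assumes "finite V" "card V = 2 * m" "0 \<notin> V" "\<And>v. v \<in> V \<Longrightarrow> - v \<in> V"
    and "S \<subseteq> V" "\<forall>v\<in>S. - v \<notin> S" "card S \<le> k" "k \<le> m"
  obtains T where "S \<subseteq> T" "T \<subseteq> V" "\<forall>v\<in>T. - v \<notin> T" "card T = k"
proof -
  have "\<exists>T. S \<subseteq> T \<and> T \<subseteq> V \<and> (\<forall>v\<in>T. - v \<notin> T) \<and> card T = k"
    using assms(7,8)
  proof (induction k rule: dec_induct)
    case base
    then show ?case using assms by blast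
  next
    case (step k)
    then obtain T where T: "S \<subseteq> T" "T \<subseteq> V" "\<forall>v\<in>T. - v \<notin> T" "card T = k"
      by auto
    have fT: "finite T"
      using T(2) assms(1) finite_subset by blast
    have "card (T \<union> uminus ` T) \<le> 2 * k"
      using card_Un_le[of T "uminus ` T"] card_image_le[OF fT, of uminus] T(4) by linarith
    then have "card (T \<union> uminus ` T) < card V"
      using step assms(2) by linarith
    then have "\<not> V \<subseteq> T \<union> uminus ` T"
      by (meson card_mono finite_UnI finite_imageI fT not_le)
    then obtain w where w: "w \<in> V" "w \<notin> T" "w \<notin> uminus ` T"
      by blast
    have "- w \<noteq> w"
      using w(1) assms(3) by (intro uminus_neq_self) auto
    moreover have "- w \<notin> T"
      using w(3) by (metis imageI minus_minus)
    ultimately have "\<forall>v\<in>insert w T. - v \<notin> insert w T"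
      using T(3) w by (auto simp: equation_minus_iff)
    moreover have "card (insert w T) = Suc k"
      using fT w T by simp
    ultimately show ?case
      using T w by (intro exI[of _ "insert w T"]) auto
  qed
  then show ?thesis using that by blast
qed

section \<open>Passing to smaller k\<close>

lemma finite_vertices_polytope:
  assumes "polytope P"
  shows "finite (vertices P)"
  using assms extreme_points_of_convex_hull finite_subset
  unfolding polytope_def vertices_def by metis

text \<open>A smaller antipode-free vertex set \<open>S\<close> is the intersection of the two antipode-free sets
  \<open>T\<close> and \<open>S \<union> -(T - S)\<close>, hence spans the intersection of two faces.\<close>

lemma cs_neighborly_mono:
  assumes nb: "cs_neighborly k P" and jk: "1 \<le> j" "j \<le> k"
  shows "cs_neighborly j P"
proof -
  let ?V = "vertices P"
  have P: "polytope P" "centrally_symmetric P"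
    using nb by (auto simp: cs_neighborly_def cs_polytope_def)
  obtain m where m: "card ?V = 2 * m" "k \<le> m"
    using nb by (auto simp: cs_neighborly_def)
  have faces: "\<exists>F. F face_of P \<and> vertices F = S"
    if "S \<subseteq> ?V" "card S = k" "\<forall>v\<in>S. - v \<notin> S" for S
    using nb that by (auto simp: cs_neighborly_def)
  have fin: "finite ?V"
    using P(1) by (rule finite_vertices_polytope)
  have uminus: "- v \<in> ?V" if "v \<in> ?V" for v
    using uminus_in_vertices P(2) that by blast
  have "0 \<notin> ?V"
    using P m(1) by (intro zero_notin_vertices) (auto simp: polytope_imp_convex)
  have "\<exists>F. F face_of P \<and> vertices F = S"
    if S: "S \<subseteq> ?V" "card S = j" "\<forall>v\<in>S. - v \<notin> S" for S
  proof -
    obtain T where T: "S \<subseteq> T" "T \<subseteq> ?V" "\<forall>v\<in>T. - v \<notin> T" "card T = k"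
      using extend_antipode_free[OF fin m(1) \<open>0 \<notin> ?V\<close> uminus S(1,3), of k] S(2) jk m(2) by metis
    define T' where "T' = S \<union> uminus ` (T - S)"
    have fT: "finite T" "finite S"
      using finite_subset[OF T(2) fin] finite_subset[OF S(1) fin] by auto
    have "card T' = card S + card (uminus ` (T - S))"
      unfolding T'_def using fT T(1,3) by (intro card_Un_disjoint) auto
    also have "\<dots> = k"
      using T(1,4) fT card_mono[OF fT(1) T(1)] by (simp add: card_image card_Diff_subset)
    finally have "card T' = k" .
    moreover have "T' \<subseteq> ?V"
      using S(1) T(2) uminus by (auto simp: T'_def)
    moreover have "\<forall>v\<in>T'. - v \<notin> T'"
      using T(1,3) by (auto simp: T'_def)
    moreover have "T \<inter> T' = S"
      using T(1,3) by (auto simp: T'_def)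
    ultimately show ?thesis
      using faces[OF T(2,4,3)] faces[of T'] vertices_Int_faces face_of_Int by metis
  qed
  moreover have "cs_polytope P" "j \<le> m"
    using nb jk m(2) by (auto simp: cs_neighborly_def)
  ultimately show ?thesis
    using m(1) jk(1) unfolding cs_neighborly_def by blast
qed

section \<open>The volume bound\<close>

lemma half_copies_disjoint:
  fixes P :: "'a::euclidean_space set"
  assumes nb: "cs_neighborly 2 P"
    and uv: "u \<in> vertices P" "v \<in> vertices P" "u \<noteq> v"
  shows "(\<lambda>x. (1/2) *\<^sub>R x + (1/2) *\<^sub>R u) ` interior P \<inter>
    (\<lambda>x. (1/2) *\<^sub>R x + (1/2) *\<^sub>R v) ` interior P = {}"
proof (rule ccontr)
  have P: "polytope P" "centrally_symmetric P"
    using nb by (auto simp: cs_neighborly_def cs_polytope_def)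
  have cP: "convex P"
    using P by (simp add: polytope_imp_convex)
  assume "\<not> ?thesis"
  then obtain p q where pq: "p \<in> interior P" "q \<in> interior P"
    and eq: "(1/2) *\<^sub>R p + (1/2) *\<^sub>R u = (1/2) *\<^sub>R q + (1/2) *\<^sub>R v"
    by blast
  define z where "z = (1/2) *\<^sub>R (u - v)"
  have z: "z = (1/2) *\<^sub>R (q - p)"
    using eq by (simp add: z_def algebra_simps)
  have "p \<in> P"
    using pq(1) interior_subset by blast
  \<comment> \<open>Moving from the point \<open>-p\<close> of \<open>P\<close> halfway towards the
    interior point \<open>q\<close> ends in the interior, and it ends exactly at
    \<open>(q - p) / 2 = z\<close>.\<close>
  then have "- p - (1/2) *\<^sub>R (- p - q) \<in> interior P"
    using centrally_symmetric_uminus[OF P(2)]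
    by (intro mem_interior_convex_shrink[OF cP pq(2)]) auto
  moreover have "- p - (1/2) *\<^sub>R (- p - q) = z"
    using scaleR_left_distrib[of "1/2" "1/2" p] by (simp add: z algebra_simps)
  ultimately have "z \<in> interior P"
    by simp
  moreover obtain F where F: "F face_of P" "F \<noteq> P" "z \<in> F"
  proof -
    obtain m where m: "card (vertices P) = 2 * m" "2 \<le> m"
      using nb by (auto simp: cs_neighborly_def)
    have v': "- v \<in> vertices P"
      using uminus_in_vertices P(2) uv(2) by blast
    have "0 \<notin> vertices P"
      using P cP m by (intro zero_notin_vertices) auto
    then have *: "- u \<noteq> u" "- v \<noteq> v"
      using uv by (auto intro!: uminus_neq_self)
    \<comment> \<open>For \<open>u = -v\<close> the pair collapses to the singleton
      \<open>{u}\<close>, which 2-neighborliness does not cover but which is a face because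
      \<open>u\<close> is extreme. Otherwise \<open>u \<noteq> v\<close> makes the pair
      antipode-free.\<close>
    have "\<exists>F. F face_of P \<and> vertices F = {u, - v}"
    proof (cases "u = - v")
      case True
      then show ?thesis
        using uv(1) by (intro exI[of _ "{u}"])
          (auto simp: vertices_def face_of_singleton)
    next
      case False
      then have "card {u, - v} = 2"
        by simp
      moreover have "\<forall>w\<in>{u, - v}. - w \<notin> {u, - v}"
        using uv(3) * by auto
      moreover have "{u, - v} \<subseteq> vertices P"
        using uv(1) v' by simp
      ultimately show ?thesis
        using nb unfolding cs_neighborly_def by blast
    qed
    then obtain F where F: "F face_of P" "vertices F = {u, - v}"
      by blast
    \<comment> \<open>\<open>P\<close> has at least four vertices, since \<open>2 \<le> m\<close>,
      so a face with at most two is proper.\<close>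
    have "card {u, - v} \<le> 2"
      by (simp add: card_insert_if)
    then have "F \<noteq> P"
      using F(2) m by auto
    moreover have "z \<in> F"
    proof -
      have "u \<in> F" "- v \<in> F"
        using F(2) vertices_subset[of F] by auto
      then show ?thesis
        using convexD_alt[OF face_of_imp_convex[OF F(1)], of u "- v" "1/2"]
        by (simp add: z_def algebra_simps)
    qed
    ultimately show ?thesis
      using that F(1) by blast
  qed
  ultimately show False
    using face_of_disjoint_interior[OF F(1,2)] by blast
qed

lemma card_vertices_two_neighborly:
  fixes P :: "'a::euclidean_space set"
  assumes nb: "cs_neighborly 2 P" and full: "aff_dim P = int DIM('a)"
  shows "card (vertices P) \<le> 2 ^ DIM('a)"
proof -
  let ?V = "vertices P" and ?f = "\<lambda>v x. (1/2) *\<^sub>R x + (1/2) *\<^sub>R v" and ?\<mu> = "measure lebesgue"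
  have P: "polytope P"
    using nb by (auto simp: cs_neighborly_def cs_polytope_def)
  have cP: "convex P" and comP: "compact P" and bP: "bounded P"
    using P by (simp_all add: polytope_imp_convex polytope_imp_compact polytope_imp_bounded)
  have fin: "finite ?V"
    using P by (rule finite_vertices_polytope)
  \<comment> \<open>Full dimension makes the interior nonempty; its volume is then positive and can
    be cancelled at the end.\<close>
  have "interior P \<noteq> {}"
    using full aff_dim_eq_full rel_interior_interior rel_interior_eq_empty[OF cP] aff_dim_empty
    by (metis of_nat_less_0_iff zero_less_one neg_less_0_iff_less)
  then have pos: "?\<mu> (interior P) > 0"
    using open_not_negligible[OF open_interior] lmeasurable_interior[OF bP]
    by (metis less_eq_real_def measure_nonneg negligible_iff_measure)
  have meas: "?f v ` interior P \<in> lmeasurable" for v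
  proof (rule lmeasurable_open)
    have "?f v ` interior P = (+) ((1/2) *\<^sub>R v) ` (*\<^sub>R) (1/2) ` interior P"
      by (simp add: image_image add.commute)
    then show "open (?f v ` interior P)" "bounded (?f v ` interior P)"
      using bP by (auto intro!: open_translation open_scaling bounded_translation bounded_scaling
          bounded_interior)
  qed
  have sub: "?f v ` interior P \<subseteq> P" if "v \<in> ?V" for v
  proof -
    have "v \<in> P"
      using that vertices_subset by blast
    then show ?thesis
      using convexD[OF cP _ \<open>v \<in> P\<close>, of _ "1/2" "1/2"] interior_subset[of P] by auto
  qed
  \<comment> \<open>A homothety of ratio 1/2 scales volume by (1/2)^d.\<close>
  have "real (card ?V) * ((1/2) ^ DIM('a) * ?\<mu> (interior P)) = (\<Sum>v\<in>?V. ?\<mu> (?f v ` interior P))"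
    by (simp add: measure_lebesgue_affine)
  also have "\<dots> = ?\<mu> (\<Union>v\<in>?V. ?f v ` interior P)"
    using fin meas half_copies_disjoint[OF nb]
    by (intro measure_negligible_finite_Union_image[symmetric]) (auto simp: pairwise_def)
  also have "\<dots> \<le> ?\<mu> P"
    using fin meas sub lmeasurable_compact[OF comP]
    by (intro measure_mono_fmeasurable) auto
  \<comment> \<open>The frontier of a convex set is a null set.\<close>
  also have "\<dots> = ?\<mu> (interior P)"
    using measure_interior[OF bP negligible_convex_frontier[OF cP]] by simp
  finally have "real (card ?V) * (1/2) ^ DIM('a) \<le> 1"
    using pos by (simp add: mult.assoc[symmetric])
  then have "real (card ?V) \<le> 2 ^ DIM('a)"
    by (simp add: power_one_over field_simps)
  then show ?thesis
    by (metis of_nat_le_iff of_nat_numeral of_nat_power)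
qed

section \<open>A polytope with 2^d + 2 vertices\<close>

text \<open>Balls are strictly convex: a point strictly inside a segment has smaller norm than one
  of the endpoints. The hull stays in the ball of radius \<open>r\<close>, so a point of norm
  \<open>r\<close> cannot lie inside a segment of the hull.\<close>

lemma vertices_convex_hull_sphere:
  fixes W :: "'a::euclidean_space set"
  assumes "W \<subseteq> sphere 0 r"
  shows "vertices (convex hull W) = W"
proof
  show "vertices (convex hull W) \<subseteq> W"
    using extreme_points_of_convex_hull by (simp add: vertices_def)
next
  have hull: "convex hull W \<subseteq> cball 0 r"
    using assms by (intro hull_minimal) auto
  show "W \<subseteq> vertices (convex hull W)"
  proof
    fix w assume w: "w \<in> W"
    have "w \<notin> open_segment a b" if "a \<in> convex hull W" "b \<in> convex hull W" for a b
    proof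
      assume "w \<in> open_segment a b"
      then have "norm w < norm a \<or> norm w < norm b"
        using dist_decreases_open_segment[of w a b 0] by simp
      moreover have "norm a \<le> r" "norm b \<le> r" "norm w = r"
        using that hull w assms by auto
      ultimately show False by linarith
    qed
    then show "w \<in> vertices (convex hull W)"
      using w by (auto simp: vertices_def extreme_point_of_def hull_inc)
  qed
qed

lemma centrally_symmetric_convex_hull:
  assumes "\<And>w. w \<in> W \<Longrightarrow> - w \<in> W"
  shows "centrally_symmetric (convex hull W)"
proof -
  have "uminus ` W = W"
    using assms by force
  then have "uminus ` (convex hull W) = convex hull W"
    using convex_hull_linear_image[of uminus W] by (simp add: linear_uminus)
  then show ?thesis
    unfolding centrally_symmetric_def by blast
qed

lemma cs_neighborly_one:
  assumes "cs_polytope P" "card (vertices P) = 2 * m" "1 \<le> m"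
  shows "cs_neighborly 1 P"
proof -
  have "\<exists>F. F face_of P \<and> vertices F = S" if "S \<subseteq> vertices P" "card S = 1" for S
  proof -
    obtain v where v: "S = {v}"
      using \<open>card S = 1\<close> card_1_singletonE by blast
    then have "{v} face_of P"
      using that by (auto simp: vertices_def face_of_singleton)
    then show ?thesis
      using v vertices_face_of[of "{v}" P] that by (intro exI[of _ "{v}"]) auto
  qed
  then show ?thesis
    using assms unfolding cs_neighborly_def by auto
qed

definition cube_points :: "(real ^ 'd) set" where
  "cube_points = {x. \<forall>i. x $ i \<in> {-1, 1}}"

lemma card_cube_points: "card (cube_points :: (real ^ 'd) set) = 2 ^ CARD('d)"
proof -
  have "bij_betw vec_nth (cube_points :: (real ^ 'd) set) (\<Pi>\<^sub>E i\<in>UNIV. {-1, 1})"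
    by (rule bij_betwI[where g = vec_lambda]) (auto simp: cube_points_def PiE_def Pi_def)
  then have "card (cube_points :: (real ^ 'd) set) = card (\<Pi>\<^sub>E i\<in>(UNIV :: 'd set). {-1, 1 :: real})"
    by (rule bij_betw_same_card)
  also have "\<dots> = 2 ^ CARD('d)"
    by (subst card_PiE) (simp_all add: card_insert_if numeral_2_eq_2)
  finally show ?thesis .
qed

lemma norm_cube_points:
  fixes x :: "real ^ 'd"
  assumes "x \<in> cube_points"
  shows "norm x = sqrt (real CARD('d))"
proof -
  have "(x $ i)\<^sup>2 = 1" for i
    using assms by (auto simp: cube_points_def power2_eq_1_iff)
  then show ?thesis
    by (simp add: norm_vec_def L2_set_def)
qed

text \<open>Half the difference of two sign vectors that differ only in coordinate \<open>i\<close>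
  is the unit vector of that coordinate, up to sign.\<close>

lemma span_cube_points: "span (cube_points :: (real ^ 'd) set) = UNIV"
proof -
  have "axis i 1 \<in> span (cube_points :: (real ^ 'd) set)" for i
  proof -
    let ?x = "(\<chi> j. 1) :: real ^ 'd" and ?y = "(\<chi> j. if j = i then - 1 else 1) :: real ^ 'd"
    have "?x \<in> cube_points" "?y \<in> cube_points"
      by (auto simp: cube_points_def)
    then have "(1/2) *\<^sub>R (?x - ?y) \<in> span (cube_points :: (real ^ 'd) set)"
      by (intro span_scale span_diff span_base)
    moreover have "axis i 1 = (1/2) *\<^sub>R (?x - ?y)"
      by (auto simp: vec_eq_iff axis_def)
    ultimately show ?thesis by simp
  qed
  then have "Basis \<subseteq> span (cube_points :: (real ^ 'd) set)"
    by (auto simp: Basis_vec_def)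
  then show ?thesis
    by (metis span_Basis span_minimal subspace_span top.extremum_uniqueI)
qed

text \<open>The count 2^d + 2 equals 2(n + d) for n = 2^(d-1) + 1 - d, and is the least even number
  above the volume bound.\<close>

lemma exists_cs_polytope_card:
  assumes "CARD('d::finite) \<ge> 2"
  obtains P :: "(real ^ 'd) set" where "cs_polytope P" "aff_dim P = int CARD('d)"
    "card (vertices P) = 2 ^ CARD('d) + 2"
proof -
  obtain i :: 'd where True by blast
  define r where "r = sqrt (real CARD('d))"
  define a :: "real ^ 'd" where "a = axis i r"
  define W where "W = insert a (insert (- a) cube_points)"
  \<comment> \<open>This is where dimension at least 2 enters: a coordinate of absolute value
    \<open>r > 1\<close> separates \<open>a\<close> and \<open>-a\<close> from the cube points,
    although all have norm \<open>r\<close>.\<close>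
  have r: "r > 1"
    using assms by (simp add: r_def)
  have a: "norm a = r" "a $ i = r"
    using r by (simp_all add: a_def norm_eq_sqrt_inner inner_axis_axis)
  have "a $ i \<notin> {-1, 1}" "(- a) $ i \<notin> {-1, 1}"
    using r a(2) by auto
  then have new: "a \<notin> cube_points" "- a \<notin> cube_points"
    unfolding cube_points_def by blast+
  have "a \<noteq> - a"
    using r a(1) uminus_neq_self[of a] by (metis norm_zero not_one_less_zero)
  have fin: "finite (cube_points :: (real ^ 'd) set)"
    using card_cube_points[where 'd = 'd] by (metis card.infinite power_not_zero zero_neq_numeral)
  have "card W = 2 ^ CARD('d) + 2"
    using new \<open>a \<noteq> - a\<close> fin card_cube_points[where 'd = 'd] by (simp add: W_def)
  have "W \<subseteq> sphere 0 r"
    using a norm_cube_points by (auto simp: W_def r_def)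
  then have V: "vertices (convex hull W) = W"
    by (rule vertices_convex_hull_sphere)
  have symm: "- w \<in> W" if "w \<in> W" for w
  proof -
    have "- w \<in> cube_points" if "w \<in> cube_points"
    proof -
      have "w $ i = - 1 \<or> w $ i = 1" for i
        using that by (simp add: cube_points_def)
      then show ?thesis
        unfolding cube_points_def by (simp, metis minus_minus)
    qed
    then show ?thesis
      using that by (auto simp: W_def)
  qed
  \<comment> \<open>As 0 is the midpoint of \<open>a\<close> and \<open>-a\<close>, the affine
    dimension of \<open>W\<close> is the dimension of its span.\<close>
  have "0 \<in> convex hull W"
    using convexD_alt[OF convex_convex_hull, of a W "- a" "1/2"]
    by (simp add: W_def hull_inc)
  then have "0 \<in> affine hull W"
    using convex_hull_subset_affine_hull by blast
  moreover have "span W = UNIV"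
    using span_mono[of cube_points W] span_cube_points by (auto simp: W_def)
  ultimately have "aff_dim W = int CARD('d)"
    by (metis DIM_cart DIM_real aff_dim_zero dim_UNIV dim_span mult.right_neutral)
  moreover have "finite W"
    using fin by (simp add: W_def)
  then have "cs_polytope (convex hull W)"
    using centrally_symmetric_convex_hull[OF symm] polytope_convex_hull
    by (simp add: cs_polytope_def)
  ultimately show ?thesis
    using that[of "convex hull W"] V \<open>card W = _\<close> by (simp add: aff_dim_convex_hull)
qed

theorem theorem1p2:
  assumes "CARD('d::finite) \<ge> 2"
  shows "max_cs_neighborliness TYPE('d) (2 ^ (CARD('d) - 1) + 1 - CARD('d)) = 1
    \<and> (\<forall>P :: (real ^ 'd) set.
          cs_neighborly 2 P \<and> aff_dim P = int CARD('d) \<longrightarrow>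
          card (vertices P) \<le> 2 ^ CARD('d))"
proof
  show bound: "\<forall>P :: (real ^ 'd) set. cs_neighborly 2 P \<and> aff_dim P = int CARD('d) \<longrightarrow>
      card (vertices P) \<le> 2 ^ CARD('d)"
    using card_vertices_two_neighborly[where 'a = "real ^ 'd"] by simp
  obtain e where e: "CARD('d) = Suc e"
    using assms by (cases "CARD('d)") auto
  \<comment> \<open>That is, d <= 2^(d-1) + 1, so the truncated subtraction on natural numbers loses
    nothing.\<close>
  have "Suc e \<le> 2 ^ e + 1"
    by (simp add: less_imp_le)
  then have n: "2 * (2 ^ (CARD('d) - 1) + 1 - CARD('d) + CARD('d)) = (2 ^ CARD('d) + 2 :: nat)"
    unfolding e by simp
  obtain P :: "(real ^ 'd) set" where P: "cs_polytope P" "aff_dim P = int CARD('d)"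
    "card (vertices P) = 2 ^ CARD('d) + 2"
    using exists_cs_polytope_card[OF assms] .
  show "max_cs_neighborliness TYPE('d) (2 ^ (CARD('d) - 1) + 1 - CARD('d)) = 1"
    unfolding max_cs_neighborliness_def n
  proof (rule Greatest_equality)
    have "cs_neighborly 1 P"
      using P(1,3) e by (intro cs_neighborly_one[where m = "2 ^ e + 1"]) auto
    then show "\<exists>P :: (real ^ 'd) set. cs_neighborly 1 P \<and> aff_dim P = int CARD('d) \<and>
        card (vertices P) = 2 ^ CARD('d) + 2"
      using P by blast
  next
    fix k
    assume "\<exists>P :: (real ^ 'd) set. cs_neighborly k P \<and> aff_dim P = int CARD('d) \<and>
        card (vertices P) = 2 ^ CARD('d) + 2"
    then obtain Q :: "(real ^ 'd) set" where Q: "cs_neighborly k Q" "aff_dim Q = int CARD('d)"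
        "card (vertices Q) = 2 ^ CARD('d) + 2"
      by blast
    show "k \<le> 1"
    proof (rule ccontr)
      assume "\<not> k \<le> 1"
      then have "cs_neighborly 2 Q"
        using cs_neighborly_mono[OF Q(1), of 2] by simp
      then show False
        using bound Q(2,3) by force
    qed
  qed
qed

end
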